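(* If $p:=n^{-\frac13+\beta}$ for some real $\beta>0$ (with $p\le 1$, so that $p$ is a probability), then asymptotically almost surely the binomial random graph $G(n,p)$ has a fractional $K_3$-decomposition.
   Context: $G(n,p)$ is the random graph on vertex set $[n]$ in which each possible edge is included independently with probability $p$. "Asymptotically almost surely" means with probability tending to $1$ as $n\to\infty$ (with $\beta$ fixed). A fractional $K_3$-decomposition of a graph $G$ is a function $\psi$ from the set of triangles of $G$ to $\mathbb R_{\ge0}$ such that for every edge $e$ of $G$ the sum of $\psi(Q)$ over all triangles $Q$ of $G$ containing $e$ equals $1$. *)

theory Defs
  imports "HOL-Probability.Probability" "HOL-Library.Ramsey"
begin

text \<open>
  A simple graph on a fixed vertex set is represented by its edge set, a set of two-element
  vertex sets; \<open>[A]\<^bsup>k\<^esup>\<close> is the library's set of \<open>k\<close>-element subsets of \<open>A\<close>.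
\<close>

definition gnp :: "nat \<Rightarrow> real \<Rightarrow> nat set set pmf" where
  "gnp n p = map_pmf (\<lambda>X. {e \<in> [{1..n}]\<^bsup>2\<^esup>. X e})
     (Pi_pmf ([{1..n}]\<^bsup>2\<^esup>) False (\<lambda>_. bernoulli_pmf p))"

text \<open>A triangle is identified with its vertex set, so that an edge \<open>e\<close> belongs to the
  triangle \<open>Q\<close> iff \<open>e \<subseteq> Q\<close>.\<close>

definition triangles :: "'a set set \<Rightarrow> 'a set set" where
  "triangles E = {Q. card Q = 3 \<and> [Q]\<^bsup>2\<^esup> \<subseteq> E}"

text \<open>Values of \<open>\<psi>\<close> outside \<open>triangles E\<close> are irrelevant. The sum is meaningful for finite \<open>E\<close>,
  where there are only finitely many triangles.\<close>

definition fractional_K3_decomposition :: "'a set set \<Rightarrow> ('a set \<Rightarrow> real) \<Rightarrow> bool" where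
  "fractional_K3_decomposition E \<psi> \<longleftrightarrow>
     (\<forall>Q\<in>triangles E. 0 \<le> \<psi> Q) \<and>
     (\<forall>e\<in>E. (\<Sum>Q\<in>{Q \<in> triangles E. e \<subseteq> Q}. \<psi> Q) = 1)"

end

theory Submission imports Defs
begin

text \<open>
  The weights are put on five-cliques rather than directly on triangles. Inside a \<open>K\<^sub>5\<close> there
  is a signed weighting of its ten triangles whose edge sums are \<open>1\<close> on a prescribed edge and \<open>0\<close>
  on the other nine (\<open>gadget_sum\<close>). Suppose every edge \<open>e\<close> of \<open>G\<close> lies in \<open>N e\<close> five-cliques
  with \<open>N e\<close> close to a common value \<open>\<mu>\<close>. Giving each triangle weight \<open>1 / (3\<mu>)\<close> for every
  five-clique containing it produces the sum \<open>N e / \<mu>\<close> at \<open>e\<close>, and the defect \<open>1 - N e / \<mu>\<close> is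
  then spread evenly over the five-cliques containing \<open>e\<close>. Base weight and corrections live in the
  same five-clique and have the same order \<open>1 / \<mu>\<close>, so a relative error of \<open>1 / 20\<close> keeps all
  weights nonnegative (\<open>decomposition_if_regular_five_cliques\<close>). With uniform base weights on the
  triangles this comparison would break down for small \<open>\<beta>\<close>: most triangles then lie in no
  five-clique, and the few others could receive corrections exceeding their base weight.

  It remains to show that asymptotically almost surely all the counts \<open>N e\<close> are within a factor
  \<open>1 \<plusminus> 1 / 20\<close> of their mean. For a pair \<open>e\<close>, let \<open>X\<close> be the number of triples \<open>T\<close> of other
  vertices such that the nine edges of the five-clique on \<open>e \<union> T\<close> other than \<open>e\<close> are present; its
  mean has order \<open>M = n\<^sup>3 p\<^sup>9\<close>, which is \<open>n\<close> to the power \<open>9\<beta>\<close>. There are about \<open>n\<^sup>2\<close> pairs,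
  so a failure probability below \<open>n\<^sup>-\<^sup>2\<close> is needed, and a sufficiently high (but fixed) central
  moment gives it. Expanding the moment of order \<open>2k\<close> yields a sum over sequences of \<open>2k\<close> triples.
  A sequence in which some triple is disjoint from all the others contributes \<open>0\<close>. In any other
  sequence at most \<open>k\<close> of the triples form a dominating set for the relation of meeting
  (\<open>dominating_set_half\<close>), so at least \<open>k\<close> triples are forced to meet triples chosen before them,
  and each of these choices costs a factor \<open>n\<close> to the power \<open>-c\<close>, where \<open>c = min (1/3) (9\<beta>)\<close>
  (\<open>extension_weight\<close>, \<open>sequence_weight\<close>). Hence the moment is at most a constant times
  \<open>M\<close> to the power \<open>2k\<close> times \<open>n\<close> to the power \<open>-ck\<close> (\<open>central_moment_bound\<close>), and Markov's
  inequality and a union bound with \<open>c k \<ge> 3\<close> finish the proof.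
\<close>

section \<open>Correcting edge weights inside five-cliques\<close>

definition five_cliques :: "'a set set \<Rightarrow> 'a set set" where
  "five_cliques E = {H. card H = 5 \<and> [H]\<^bsup>2\<^esup> \<subseteq> E}"

text \<open>The weight, in a \<open>K\<^sub>5\<close>, of a triangle having \<open>k\<close> vertices in common with the edge to be
  corrected. Up to the normalisation \<open>3 * gadget 2 = 1\<close> at that edge, the values are forced by the
  vanishing of the sums at the edges meeting it in one vertex (\<open>gadget 2 + 2 * gadget 1 = 0\<close>) and
  at the edges disjoint from it (\<open>2 * gadget 1 + gadget 0 = 0\<close>).\<close>

definition gadget :: "nat \<Rightarrow> real" where
  "gadget k = (if k = 1 then - 1 / 6 else 1 / 3)"

lemma clique_subset_Union:
  assumes "2 \<le> card Q" "[Q]\<^bsup>2\<^esup> \<subseteq> E"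
  shows "Q \<subseteq> \<Union>E"
proof
  fix x assume x: "x \<in> Q"
  have "\<not> Q \<subseteq> {x}" using assms(1) card_mono[of "{x}" Q] by auto
  then obtain y where "y \<in> Q" "y \<noteq> x" by auto
  then have "{x, y} \<in> [Q]\<^bsup>2\<^esup>" using x by simp
  then show "x \<in> \<Union>E" using assms(2) by blast
qed

lemma three_subsets_containing_pair:
  assumes H: "finite H" and f: "f \<in> [H]\<^bsup>2\<^esup>"
  shows "{Q \<in> [H]\<^bsup>3\<^esup>. f \<subseteq> Q} = (\<lambda>z. insert z f) ` (H - f)"
    and "inj_on (\<lambda>z. insert z f) (H - f)"
proof -
  have f': "f \<subseteq> H" "finite f" "card f = 2" using f by (auto simp: nsets_def)
  show "{Q \<in> [H]\<^bsup>3\<^esup>. f \<subseteq> Q} = (\<lambda>z. insert z f) ` (H - f)"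
  proof (intro set_eqI iffI)
    fix Q assume "Q \<in> {Q \<in> [H]\<^bsup>3\<^esup>. f \<subseteq> Q}"
    then have Q: "Q \<subseteq> H" "finite Q" "card Q = 3" "f \<subseteq> Q" by (auto simp: nsets_def)
    then have "card (Q - f) = 1" using f' by (simp add: card_Diff_subset)
    then obtain z where "Q - f = {z}" by (auto simp: card_1_singleton_iff)
    then show "Q \<in> (\<lambda>z. insert z f) ` (H - f)" using Q by blast
  qed (use f' in \<open>auto simp: nsets_def\<close>)
qed (auto simp: inj_on_def)

text \<open>The triangles on \<open>f\<close> are the sets \<open>insert z f\<close> for the three remaining vertices \<open>z\<close> of \<open>H\<close>.
  If \<open>e\<close> and \<open>f\<close> share \<open>k\<close> vertices, then \<open>2 - k\<close> of these three lie in \<open>e\<close>, which reduces the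
  claim to one numerical identity for each \<open>k\<close>.\<close>

lemma gadget_sum:
  assumes H: "card H = 5" and e: "e \<in> [H]\<^bsup>2\<^esup>" and f: "f \<in> [H]\<^bsup>2\<^esup>"
  shows "(\<Sum>Q\<in>{Q \<in> [H]\<^bsup>3\<^esup>. f \<subseteq> Q}. gadget (card (e \<inter> Q))) = (if e = f then 1 else 0)"
proof -
  have fin: "finite H" using H by (simp add: card_ge_0_finite)
  have e': "e \<subseteq> H" "finite e" "card e = 2" and f': "f \<subseteq> H" "finite f" "card f = 2"
    using e f by (auto simp: nsets_def)
  define k where "k = card (e \<inter> f)"
  note Q_eq = three_subsets_containing_pair(1)[OF fin f]
  note inj = three_subsets_containing_pair(2)[OF fin f]
  have split: "H - f = (e - f) \<union> (H - f - e)" using e' by auto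
  have card1: "card (e - f) = 2 - k"
    using e' f' by (simp add: card_Diff_subset_Int k_def)
  have kle: "k \<le> 2" using e' by (metis card_mono inf_le1 k_def)
  have "card (H - f) = 3" using f' fin H by (simp add: card_Diff_subset)
  moreover have "card (H - f) = card (e - f) + card (H - f - e)"
    by (subst split, rule card_Un_disjoint) (use fin e' in auto)
  ultimately have card2: "card (H - f - e) = k + 1" using card1 kle by simp
  have "(\<Sum>Q\<in>{Q \<in> [H]\<^bsup>3\<^esup>. f \<subseteq> Q}. gadget (card (e \<inter> Q)))
      = (\<Sum>z\<in>H - f. gadget (card (e \<inter> insert z f)))"
    unfolding Q_eq by (simp add: sum.reindex[OF inj])
  also have "\<dots> = (\<Sum>z\<in>e - f. gadget (card (e \<inter> insert z f)))
      + (\<Sum>z\<in>H - f - e. gadget (card (e \<inter> insert z f)))"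
    by (subst split, rule sum.union_disjoint) (use fin e' in auto)
  also have "(\<Sum>z\<in>e - f. gadget (card (e \<inter> insert z f))) = (\<Sum>z\<in>e - f. gadget (Suc k))"
    by (rule sum.cong) (use e' in \<open>auto simp: Int_insert_right k_def\<close>)
  also have "(\<Sum>z\<in>H - f - e. gadget (card (e \<inter> insert z f))) = (\<Sum>z\<in>H - f - e. gadget k)"
    by (rule sum.cong) (auto simp: Int_insert_right k_def)
  also have "(\<Sum>z\<in>e - f. gadget (Suc k)) + (\<Sum>z\<in>H - f - e. gadget k)
      = (if k = 2 then 1 else 0)"
    using kle by (auto simp: card1 card2 gadget_def le_Suc_eq numeral_2_eq_2)
  also have "k = 2 \<longleftrightarrow> e = f"
  proof
    assume "k = 2"
    then have "e \<inter> f = e" "e \<inter> f = f"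
      using e' f' by (metis card_subset_eq inf_le1 inf_le2 k_def)+
    then show "e = f" by simp
  qed (use e' in \<open>simp add: k_def\<close>)
  finally show ?thesis .
qed

text \<open>A defect \<open>\<delta> e\<close> at an edge \<open>e\<close> is distributed evenly over the five-cliques containing \<open>e\<close>, each
  absorbing its share by the signed weighting above without disturbing any other edge.
  Nonnegativity is checked separately inside each five-clique: each of its ten edges lowers the
  weight of a triangle by at most \<open>(1/20) / (19\<mu>/20) / 3 = 1 / (57\<mu>)\<close>, and
  \<open>10 / 57 \<le> 1 / 3\<close>.\<close>

lemma decomposition_if_regular_five_cliques:
  assumes fin: "finite E" and \<mu>: "\<mu> > 0"
    and reg: "\<And>e. e \<in> E \<Longrightarrow> \<bar>real (card {H \<in> five_cliques E. e \<subseteq> H}) - \<mu>\<bar> \<le> \<mu> / 20"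
    and two: "\<And>e. e \<in> E \<Longrightarrow> card e = 2"
  shows "\<exists>\<psi>. fractional_K3_decomposition E \<psi>"
proof -
  define N where "N e = real (card {H \<in> five_cliques E. e \<subseteq> H})" for e
  define \<delta> where "\<delta> e = 1 - N e / \<mu>" for e
  \<comment> \<open>the contribution of a five-clique \<open>H\<close> to a triangle \<open>Q\<close> in it\<close>
  define w where "w H Q = 1 / (3 * \<mu>) + (\<Sum>e\<in>[H]\<^bsup>2\<^esup>. \<delta> e / N e * gadget (card (e \<inter> Q)))" for H Q
  define \<psi> where "\<psi> Q = (\<Sum>H\<in>{H \<in> five_cliques E. Q \<subseteq> H}. w H Q)" for Q
  have N_ge: "N e \<ge> 19 / 20 * \<mu>" and \<delta>_le: "\<bar>\<delta> e\<bar> \<le> 1 / 20" if "e \<in> E" for e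
  proof -
    have r: "\<bar>N e - \<mu>\<bar> \<le> \<mu> / 20" using reg[OF that] by (simp add: N_def)
    then show "N e \<ge> 19 / 20 * \<mu>" by linarith
    have "N e - \<mu> = - (\<delta> e * \<mu>)" using \<mu> by (simp add: \<delta>_def field_simps)
    then have "\<bar>\<delta> e\<bar> * \<mu> \<le> (1 / 20) * \<mu>"
      using r \<mu> by (simp only: abs_minus_cancel abs_mult abs_of_pos)
    then show "\<bar>\<delta> e\<bar> \<le> 1 / 20" using \<mu> by (rule mult_right_le_imp_le)
  qed
  have finV: "finite (\<Union>E)"
    using fin two by (metis card.infinite finite_Union zero_neq_numeral)
  have K5_sub: "H \<subseteq> \<Union>E" if "H \<in> five_cliques E" for H
    by (rule clique_subset_Union) (use that in \<open>auto simp: five_cliques_def\<close>)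
  have finK: "finite (five_cliques E)"
    by (rule finite_subset[of _ "Pow (\<Union>E)"]) (use K5_sub finV in auto)
  have H_fin: "finite H" if "H \<in> five_cliques E" for H
    using K5_sub[OF that] finV finite_subset by blast
  have w_nonneg: "w H Q \<ge> 0" if H: "H \<in> five_cliques E" for H Q
  proof -
    have cH: "card H = 5" "[H]\<^bsup>2\<^esup> \<subseteq> E" using H by (auto simp: five_cliques_def)
    have "\<bar>\<Sum>e\<in>[H]\<^bsup>2\<^esup>. \<delta> e / N e * gadget (card (e \<inter> Q))\<bar>
        \<le> (\<Sum>e\<in>[H]\<^bsup>2\<^esup>. \<bar>\<delta> e / N e * gadget (card (e \<inter> Q))\<bar>)" by (rule sum_abs)
    also have "\<dots> \<le> (\<Sum>e\<in>[H]\<^bsup>2\<^esup>. 1 / (57 * \<mu>))"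
    proof (rule sum_mono)
      fix e assume "e \<in> [H]\<^bsup>2\<^esup>"
      then have e: "e \<in> E" using cH by auto
      have Np: "N e > 0" using N_ge[OF e] \<mu> by (smt (verit) mult_pos_pos zero_less_divide_iff)
      have "\<bar>\<delta> e / N e * gadget (card (e \<inter> Q))\<bar>
          = \<bar>\<delta> e\<bar> * (1 / N e) * \<bar>gadget (card (e \<inter> Q))\<bar>"
        using Np by (simp add: abs_mult)
      also have "\<dots> \<le> (1 / 20) * (1 / (19 / 20 * \<mu>)) * (1 / 3)"
        using \<delta>_le[OF e] N_ge[OF e] Np \<mu>
        by (intro mult_mono frac_le mult_nonneg_nonneg) (auto simp: gadget_def)
      also have "\<dots> = 1 / (57 * \<mu>)" using \<mu> by (simp add: field_simps)
      finally show "\<bar>\<delta> e / N e * gadget (card (e \<inter> Q))\<bar> \<le> 1 / (57 * \<mu>)" .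
    qed
    also have "\<dots> = real (card ([H]\<^bsup>2\<^esup>)) * (1 / (57 * \<mu>))" by simp
    also have "card ([H]\<^bsup>2\<^esup>) = 10"
      using cH H_fin[OF H] by (simp add: card_nsets numeral_eq_Suc)
    also have "real 10 * (1 / (57 * \<mu>)) \<le> 1 / (3 * \<mu>)" using \<mu> by (simp add: field_simps)
    finally show ?thesis unfolding w_def by linarith
  qed
  have tri: "{Q \<in> triangles E. f \<subseteq> Q \<and> Q \<subseteq> H} = {Q \<in> [H]\<^bsup>3\<^esup>. f \<subseteq> Q}"
    if H: "H \<in> five_cliques E" for f H
  proof -
    have "[Q]\<^bsup>2\<^esup> \<subseteq> E" if "Q \<subseteq> H" for Q
      using nsets_mono[OF that] H by (fastforce simp: five_cliques_def)
    then show ?thesis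
      using H_fin[OF H] by (auto simp: triangles_def nsets_def dest: finite_subset)
  qed
  have "(\<Sum>Q\<in>{Q \<in> triangles E. f \<subseteq> Q}. \<psi> Q) = 1" if f: "f \<in> E" for f
  proof -
    have f2: "card f = 2" "finite f" using two[OF f] by (auto intro: card_ge_0_finite)
    have finT: "finite (triangles E)"
    proof (rule finite_subset)
      show "triangles E \<subseteq> Pow (\<Union>E)"
      proof
        fix Q assume "Q \<in> triangles E"
        then have "Q \<subseteq> \<Union>E" by (intro clique_subset_Union) (simp_all add: triangles_def)
        then show "Q \<in> Pow (\<Union>E)" by simp
      qed
    qed (use finV in simp)
    have "(\<Sum>Q\<in>{Q \<in> triangles E. f \<subseteq> Q}. \<psi> Q)
        = (\<Sum>Q\<in>{Q \<in> triangles E. f \<subseteq> Q}. \<Sum>H\<in>{H \<in> five_cliques E. Q \<subseteq> H}. w H Q)"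
      by (simp add: \<psi>_def)
    also have "\<dots> = (\<Sum>H\<in>five_cliques E. \<Sum>Q\<in>{Q \<in> triangles E. f \<subseteq> Q \<and> Q \<subseteq> H}. w H Q)"
      using finT finK by (subst sum.swap_restrict) (auto simp: conj_ac intro!: sum.cong)
    also have "\<dots> = (\<Sum>H\<in>{H \<in> five_cliques E. f \<subseteq> H}.
        \<Sum>Q\<in>{Q \<in> [H]\<^bsup>3\<^esup>. f \<subseteq> Q}. w H Q)"
    proof (rule sum.mono_neutral_cong_right[OF finK])
      show "\<forall>H\<in>five_cliques E - {H \<in> five_cliques E. f \<subseteq> H}.
          (\<Sum>Q\<in>{Q \<in> triangles E. f \<subseteq> Q \<and> Q \<subseteq> H}. w H Q) = 0"
        by (auto intro!: sum.neutral)
    qed (auto simp: tri)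
    also have "\<dots> = (\<Sum>H\<in>{H \<in> five_cliques E. f \<subseteq> H}. 1 / \<mu> + \<delta> f / N f)"
    proof (rule sum.cong[OF refl])
      fix H assume "H \<in> {H \<in> five_cliques E. f \<subseteq> H}"
      then have H: "H \<in> five_cliques E" "card H = 5" "f \<subseteq> H" by (auto simp: five_cliques_def)
      have f': "f \<in> [H]\<^bsup>2\<^esup>" using f2 H by (simp add: nsets_def)
      have fin2: "finite ([H]\<^bsup>2\<^esup>)" by (rule finite_imp_finite_nsets[OF H_fin[OF H(1)]])
      have three: "(\<Sum>Q\<in>{Q \<in> [H]\<^bsup>3\<^esup>. f \<subseteq> Q}. 1 / (3 * \<mu>)) = 1 / \<mu>"
      proof -
        have "card {Q \<in> [H]\<^bsup>3\<^esup>. f \<subseteq> Q} = 3"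
          using three_subsets_containing_pair[OF H_fin[OF H(1)] f'] f2 H
          by (simp add: card_image card_Diff_subset)
        then show ?thesis by simp
      qed
      have "(\<Sum>Q\<in>{Q \<in> [H]\<^bsup>3\<^esup>. f \<subseteq> Q}. \<Sum>e\<in>[H]\<^bsup>2\<^esup>. \<delta> e / N e * gadget (card (e \<inter> Q)))
          = (\<Sum>e\<in>[H]\<^bsup>2\<^esup>. \<delta> e / N e * (if e = f then 1 else 0))"
        by (subst sum.swap)
          (simp only: sum_distrib_left[symmetric] gadget_sum[OF H(2) _ f'] cong: sum.cong)
      also have "\<dots> = (\<Sum>e\<in>[H]\<^bsup>2\<^esup>. if e = f then \<delta> f / N f else 0)"
        by (rule sum.cong) auto
      also have "\<dots> = \<delta> f / N f" using f' fin2 by simp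
      finally show "(\<Sum>Q\<in>{Q \<in> [H]\<^bsup>3\<^esup>. f \<subseteq> Q}. w H Q) = 1 / \<mu> + \<delta> f / N f"
        by (simp add: w_def sum.distrib three del: sum_constant)
    qed
    also have "\<dots> = N f * (1 / \<mu> + \<delta> f / N f)" by (simp add: N_def)
    also have "\<dots> = N f / \<mu> + \<delta> f"
      using N_ge[OF f] \<mu> by (simp add: field_simps)
    also have "\<dots> = 1" by (simp add: \<delta>_def)
    finally show ?thesis .
  qed
  moreover have "\<psi> Q \<ge> 0" for Q
    unfolding \<psi>_def by (rule sum_nonneg) (use w_nonneg in auto)
  ultimately show ?thesis unfolding fractional_K3_decomposition_def by blast
qed

section \<open>Moments of edge indicators in the binomial random graph\<close>

lemma set_pmf_gnp: "set_pmf (gnp n p) \<subseteq> Pow ([{1..n}]\<^bsup>2\<^esup>)"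
  by (auto simp: gnp_def)

lemma integrable_gnp: "integrable (measure_pmf (gnp n p)) (f :: nat set set \<Rightarrow> real)"
  by (rule integrable_measure_pmf_finite)
    (rule finite_subset[OF set_pmf_gnp], simp add: finite_imp_finite_nsets)

lemma expectation_gnp_contains:
  assumes p: "0 \<le> p" "p \<le> 1" and U: "U \<subseteq> [{1..n}]\<^bsup>2\<^esup>"
  shows "measure_pmf.expectation (gnp n p) (\<lambda>G. of_bool (U \<subseteq> G)) = p ^ card U"
proof -
  let ?E = "[{1..n}]\<^bsup>2\<^esup>"
  have fin: "finite ?E" by (simp add: finite_imp_finite_nsets)
  have finU: "finite U" using U fin finite_subset by blast
  have "measure_pmf.expectation (gnp n p) (\<lambda>G. of_bool (U \<subseteq> G))
      = measure_pmf.expectation (Pi_pmf ?E False (\<lambda>_. bernoulli_pmf p))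
          (\<lambda>X. \<Prod>e\<in>?E. if e \<in> U then of_bool (X e) else (1::real))"
  proof -
    have "of_bool (U \<subseteq> {e \<in> ?E. X e}) = (\<Prod>e\<in>?E. if e \<in> U then of_bool (X e) else (1::real))" for X
    proof -
      have "(\<Prod>e\<in>?E. if e \<in> U then of_bool (X e) else (1::real)) = (\<Prod>e\<in>U. of_bool (X e))"
        by (rule prod.mono_neutral_cong_right[OF fin U]) auto
      also have "\<dots> = of_bool (U \<subseteq> {e \<in> ?E. X e})"
        using U finU by (auto simp: subset_iff)
      finally show ?thesis by simp
    qed
    then show ?thesis by (simp add: gnp_def)
  qed
  also have "\<dots> = (\<Prod>e\<in>?E. measure_pmf.expectation (bernoulli_pmf p)
      (\<lambda>b. if e \<in> U then of_bool b else (1::real)))"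
    by (rule expectation_prod_Pi_pmf[OF fin])
      (auto intro!: integrable_measure_pmf_finite)
  also have "\<dots> = (\<Prod>e\<in>?E. if e \<in> U then p else 1)"
    using p by (intro prod.cong) auto
  also have "\<dots> = (\<Prod>e\<in>U. p)"
    by (rule prod.mono_neutral_cong_right[OF fin U]) auto
  finally show ?thesis by simp
qed

lemma prod_of_bool_subset:
  "finite I \<Longrightarrow> (\<Prod>i\<in>I. of_bool (A i \<subseteq> G)) = (of_bool (\<Union>(A ` I) \<subseteq> G) :: real)"
  by (induction I rule: finite_induct) auto

text \<open>Expanding the product, the term in which the indicators of \<open>B \<subseteq> I\<close> are selected has
  absolute value \<open>p\<close> to the power \<open>card (\<Union>(A ` B)) + (\<Sum>i\<in>I - B. card (A i))\<close>, an exponent at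
  least the size of the whole union.\<close>

lemma centred_product_bound:
  assumes p: "0 \<le> p" "p \<le> 1" and I: "finite I" and A: "\<And>i. i \<in> I \<Longrightarrow> A i \<subseteq> [{1..n}]\<^bsup>2\<^esup>"
  shows "\<bar>measure_pmf.expectation (gnp n p) (\<lambda>G. \<Prod>i\<in>I. of_bool (A i \<subseteq> G) - p ^ card (A i))\<bar>
    \<le> 2 ^ card I * p ^ card (\<Union>(A ` I))"
proof -
  let ?E = "measure_pmf.expectation (gnp n p)"
  have "?E (\<lambda>G. \<Prod>i\<in>I. of_bool (A i \<subseteq> G) - p ^ card (A i))
      = ?E (\<lambda>G. \<Sum>B\<in>Pow I. of_bool (\<Union>(A ` B) \<subseteq> G) * (\<Prod>i\<in>I - B. - (p ^ card (A i))))"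
  proof (rule Bochner_Integration.integral_cong[OF refl])
    fix G
    have "(\<Prod>i\<in>I. of_bool (A i \<subseteq> G) - p ^ card (A i))
        = (\<Prod>i\<in>I. of_bool (A i \<subseteq> G) + (- (p ^ card (A i))))" by simp
    also have "\<dots> = (\<Sum>B\<in>Pow I. (\<Prod>i\<in>B. of_bool (A i \<subseteq> G)) * (\<Prod>i\<in>I - B. - (p ^ card (A i))))"
      by (rule prod_add[OF I])
    also have "\<dots> = (\<Sum>B\<in>Pow I. of_bool (\<Union>(A ` B) \<subseteq> G) * (\<Prod>i\<in>I - B. - (p ^ card (A i))))"
      by (rule sum.cong) (use I in \<open>auto simp: prod_of_bool_subset finite_subset\<close>)
    finally show "(\<Prod>i\<in>I. of_bool (A i \<subseteq> G) - p ^ card (A i)) = \<dots>" .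
  qed
  also have "\<dots> = (\<Sum>B\<in>Pow I. p ^ card (\<Union>(A ` B)) * (\<Prod>i\<in>I - B. - (p ^ card (A i))))"
  proof (subst Bochner_Integration.integral_sum)
    show "(\<Sum>B\<in>Pow I. ?E (\<lambda>G. of_bool (\<Union>(A ` B) \<subseteq> G) * (\<Prod>i\<in>I - B. - (p ^ card (A i)))))
      = (\<Sum>B\<in>Pow I. p ^ card (\<Union>(A ` B)) * (\<Prod>i\<in>I - B. - (p ^ card (A i))))"
    proof (rule sum.cong[OF refl])
      fix B assume "B \<in> Pow I"
      then have "\<Union>(A ` B) \<subseteq> [{1..n}]\<^bsup>2\<^esup>" using A by blast
      then show "?E (\<lambda>G. of_bool (\<Union>(A ` B) \<subseteq> G) * (\<Prod>i\<in>I - B. - (p ^ card (A i))))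
        = p ^ card (\<Union>(A ` B)) * (\<Prod>i\<in>I - B. - (p ^ card (A i)))"
        using expectation_gnp_contains[OF p] by simp
    qed
  qed (rule integrable_gnp)
  also have "\<bar>\<dots>\<bar> \<le> (\<Sum>B\<in>Pow I. \<bar>p ^ card (\<Union>(A ` B)) * (\<Prod>i\<in>I - B. - (p ^ card (A i)))\<bar>)"
    by (rule sum_abs)
  also have "\<dots> \<le> (\<Sum>B\<in>Pow I. p ^ card (\<Union>(A ` I)))"
  proof (rule sum_mono)
    fix B assume B: "B \<in> Pow I"
    have "\<bar>p ^ card (\<Union>(A ` B)) * (\<Prod>i\<in>I - B. - (p ^ card (A i)))\<bar>
        = p ^ (card (\<Union>(A ` B)) + (\<Sum>i\<in>I - B. card (A i)))"
      using p by (simp add: abs_mult abs_prod power_sum power_add)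
    also have "\<dots> \<le> p ^ card (\<Union>(A ` I))"
    proof (rule power_decreasing)
      have "\<Union>(A ` I) = \<Union>(A ` B) \<union> \<Union>(A ` (I - B))" using B by auto
      then have "card (\<Union>(A ` I)) \<le> card (\<Union>(A ` B)) + card (\<Union>(A ` (I - B)))"
        by (simp add: card_Un_le)
      also have "card (\<Union>(A ` (I - B))) \<le> (\<Sum>i\<in>I - B. card (A i))"
        by (rule card_UN_le) (use I in simp)
      finally show "card (\<Union>(A ` I)) \<le> card (\<Union>(A ` B)) + (\<Sum>i\<in>I - B. card (A i))" by simp
    qed (use p in auto)
    finally show "\<bar>p ^ card (\<Union>(A ` B)) * (\<Prod>i\<in>I - B. - (p ^ card (A i)))\<bar> \<le> p ^ card (\<Union>(A ` I))" .
  qed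
  also have "\<dots> = 2 ^ card I * p ^ card (\<Union>(A ` I))" using I by (simp add: card_Pow)
  finally show ?thesis .
qed

text \<open>The factor with index \<open>k\<close> depends on edges that no other factor looks at, so it is
  independent of the rest, and it has mean \<open>0\<close>. Only the other factors are expanded.\<close>

lemma centred_product_zero:
  assumes p: "0 \<le> p" "p \<le> 1" and I: "finite I" and A: "\<And>i. i \<in> I \<Longrightarrow> A i \<subseteq> [{1..n}]\<^bsup>2\<^esup>"
    and k: "k \<in> I" and disj: "\<And>i. i \<in> I - {k} \<Longrightarrow> A i \<inter> A k = {}"
  shows "measure_pmf.expectation (gnp n p) (\<lambda>G. \<Prod>i\<in>I. of_bool (A i \<subseteq> G) - p ^ card (A i)) = 0"
proof -
  let ?E = "measure_pmf.expectation (gnp n p)" and ?J = "I - {k}"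
  let ?c = "\<lambda>B. \<Prod>i\<in>?J - B. - (p ^ card (A i))"
  have finA: "finite (A i)" if "i \<in> I" for i
    using A[OF that] finite_imp_finite_nsets[of "{1..n}" 2] finite_subset by blast
  have "?E (\<lambda>G. \<Prod>i\<in>I. of_bool (A i \<subseteq> G) - p ^ card (A i))
      = ?E (\<lambda>G. \<Sum>B\<in>Pow ?J. (of_bool (A k \<union> \<Union>(A ` B) \<subseteq> G)
          - p ^ card (A k) * of_bool (\<Union>(A ` B) \<subseteq> G)) * ?c B)"
  proof (rule Bochner_Integration.integral_cong[OF refl])
    fix G
    have "(\<Prod>i\<in>I. of_bool (A i \<subseteq> G) - p ^ card (A i))
        = (of_bool (A k \<subseteq> G) - p ^ card (A k)) * (\<Prod>i\<in>?J. of_bool (A i \<subseteq> G) + (- (p ^ card (A i))))"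
      using I k by (simp add: prod.remove)
    also have "(\<Prod>i\<in>?J. of_bool (A i \<subseteq> G) + (- (p ^ card (A i))))
        = (\<Sum>B\<in>Pow ?J. (\<Prod>i\<in>B. of_bool (A i \<subseteq> G)) * ?c B)"
      by (rule prod_add) (use I in simp)
    also have "\<dots> = (\<Sum>B\<in>Pow ?J. of_bool (\<Union>(A ` B) \<subseteq> G) * ?c B)"
    proof (rule sum.cong[OF refl])
      fix B assume "B \<in> Pow ?J"
      then have "finite B" using I by (auto dest: finite_subset)
      then show "(\<Prod>i\<in>B. of_bool (A i \<subseteq> G)) * ?c B = of_bool (\<Union>(A ` B) \<subseteq> G) * ?c B"
        by (simp only: prod_of_bool_subset)
    qed
    also have "(of_bool (A k \<subseteq> G) - p ^ card (A k)) * \<dots> = (\<Sum>B\<in>Pow ?J. (of_bool (A k \<union> \<Union>(A ` B) \<subseteq> G)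
          - p ^ card (A k) * of_bool (\<Union>(A ` B) \<subseteq> G)) * ?c B)"
      unfolding sum_distrib_left by (rule sum.cong[OF refl]) (auto simp: algebra_simps)
    finally show "(\<Prod>i\<in>I. of_bool (A i \<subseteq> G) - p ^ card (A i)) = \<dots>" .
  qed
  also have "\<dots> = (\<Sum>B\<in>Pow ?J. ?E (\<lambda>G. (of_bool (A k \<union> \<Union>(A ` B) \<subseteq> G)
          - p ^ card (A k) * of_bool (\<Union>(A ` B) \<subseteq> G)) * ?c B))"
    by (rule Bochner_Integration.integral_sum) (rule integrable_gnp)
  also have "\<dots> = (\<Sum>B\<in>Pow ?J. 0)"
  proof (rule sum.cong[OF refl])
    fix B assume B: "B \<in> Pow ?J"
    have sub: "\<Union>(A ` B) \<subseteq> [{1..n}]\<^bsup>2\<^esup>" using A B by blast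
    have "card (A k \<union> \<Union>(A ` B)) = card (A k) + card (\<Union>(A ` B))"
      by (rule card_Un_disjoint)
        (use B I finA k disj in \<open>auto intro!: finite_UN_I dest: finite_subset\<close>)
    then show "?E (\<lambda>G. (of_bool (A k \<union> \<Union>(A ` B) \<subseteq> G)
          - p ^ card (A k) * of_bool (\<Union>(A ` B) \<subseteq> G)) * ?c B) = 0"
      using expectation_gnp_contains[OF p, of "A k \<union> \<Union>(A ` B)" n]
        expectation_gnp_contains[OF p sub] A[OF k] sub
      by (simp add: integrable_gnp power_add del: Un_subset_iff UN_subset_iff)
  qed
  finally show ?thesis by simp
qed

section \<open>Sequences of triples rooted at an edge\<close>

text \<open>The root \<open>e\<close> is left out, so that the count of extensions of \<open>e\<close> is
  defined, and has the same distribution, whether or not \<open>e\<close> itself is an edge of the random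
  graph.\<close>

definition rooted_edges :: "'a set \<Rightarrow> 'a set \<Rightarrow> 'a set set" where
  "rooted_edges e T = [e \<union> T]\<^bsup>2\<^esup> - {e}"

text \<open>Disjoint triples therefore give independent events, so dependence can be read off from
  the triples instead of the edge sets.\<close>

lemma rooted_edges_disjoint:
  assumes "finite e" "card e = 2" "S \<inter> T = {}"
  shows "rooted_edges e S \<inter> rooted_edges e T = {}"
proof (rule ccontr)
  assume "rooted_edges e S \<inter> rooted_edges e T \<noteq> {}"
  then obtain d where "d \<subseteq> e \<union> S" "d \<subseteq> e \<union> T" "card d = 2" "d \<noteq> e"
    by (auto simp: rooted_edges_def nsets_def)
  then have "d \<subseteq> e" using assms(3) by blast
  then show False using \<open>card d = 2\<close> \<open>d \<noteq> e\<close> assms card_subset_eq by metis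
qed

lemma card_rooted_edges:
  assumes e: "finite e" "card e = 2" and T: "finite T" "e \<inter> T = {}"
  shows "finite (rooted_edges e T)" and "card (rooted_edges e T) = (card T + 2 choose 2) - 1"
proof -
  have "e \<in> [e \<union> T]\<^bsup>2\<^esup>" using e by (simp add: nsets_def)
  moreover have "card ([e \<union> T]\<^bsup>2\<^esup>) = (card T + 2 choose 2)"
    using e T by (simp add: card_Un_disjoint add.commute)
  ultimately show "card (rooted_edges e T) = (card T + 2 choose 2) - 1"
    using e by (simp add: rooted_edges_def)
  show "finite (rooted_edges e T)"
    using e T by (simp add: rooted_edges_def finite_imp_finite_nsets)
qed

lemma card_subsets_meeting_in:
  assumes V: "finite V" and W: "finite W" and v: "v \<le> r"
  shows "card {T \<in> [V]\<^bsup>r\<^esup>. card (T \<inter> W) = v} \<le> card W ^ v * card V ^ (r - v)"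
proof -
  have le_pow: "N choose j \<le> N ^ j" for N j :: nat
    by (cases "j \<le> N") (simp_all add: binomial_le_pow binomial_eq_0)
  have "card {T \<in> [V]\<^bsup>r\<^esup>. card (T \<inter> W) = v} \<le> card ([W]\<^bsup>v\<^esup> \<times> [V]\<^bsup>(r - v)\<^esup>)"
  proof (rule card_inj_on_le[where f = "\<lambda>T. (T \<inter> W, T - W)"])
    show "inj_on (\<lambda>T. (T \<inter> W, T - W)) {T \<in> [V]\<^bsup>r\<^esup>. card (T \<inter> W) = v}"
      by (rule inj_onI) blast
    show "(\<lambda>T. (T \<inter> W, T - W)) ` {T \<in> [V]\<^bsup>r\<^esup>. card (T \<inter> W) = v} \<subseteq> [W]\<^bsup>v\<^esup> \<times> [V]\<^bsup>(r - v)\<^esup>"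
      using W by (auto simp: nsets_def card_Diff_subset_Int)
    show "finite ([W]\<^bsup>v\<^esup> \<times> [V]\<^bsup>(r - v)\<^esup>)"
      using V W by (simp add: finite_imp_finite_nsets)
  qed
  also have "\<dots> \<le> card W ^ v * card V ^ (r - v)"
    by (simp add: card_cartesian_product mult_le_mono le_pow)
  finally show ?thesis .
qed

text \<open>Here \<open>U\<close> stands for edges already accounted for, with all vertices in \<open>e \<union> W\<close>. A triple with
  \<open>v\<close> vertices in \<open>W\<close> shares at most \<open>(v + 2 choose 2) - 1\<close> of its nine edges with \<open>U\<close>, hence
  costs at least \<open>10 - (v + 2 choose 2)\<close> further edges, while there are at most
  \<open>card W ^ v * card V ^ (3 - v)\<close> such triples.\<close>

lemma extension_weight_level:
  fixes p :: real
  assumes p: "0 < p" "p \<le> 1" and V: "finite V" and e: "e \<in> [V]\<^bsup>2\<^esup>"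
    and W: "finite W" and U: "U \<subseteq> [e \<union> W]\<^bsup>2\<^esup>" and v: "v \<le> 3"
  shows "(\<Sum>T\<in>{T \<in> [V - e]\<^bsup>3\<^esup>. card (T \<inter> W) = v}. p ^ card (rooted_edges e T - U))
    \<le> real (card W) ^ v * (real (card V) ^ (3 - v) * p ^ (10 - (v + 2 choose 2)))"
proof -
  have e': "finite e" "card e = 2" using e by (auto simp: nsets_def)
  let ?S = "{T \<in> [V - e]\<^bsup>3\<^esup>. card (T \<inter> W) = v}"
  have "(\<Sum>T\<in>?S. p ^ card (rooted_edges e T - U)) \<le> (\<Sum>T\<in>?S. p ^ (10 - (v + 2 choose 2)))"
  proof (rule sum_mono, rule power_decreasing)
    fix T assume "T \<in> ?S"
    then have T: "finite T" "card T = 3" "e \<inter> T = {}" "card (T \<inter> W) = v"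
      by (auto simp: nsets_def)
    have "rooted_edges e T \<inter> U \<subseteq> rooted_edges e (T \<inter> W)"
      using U by (auto simp: rooted_edges_def nsets_def)
    then have "card (rooted_edges e T \<inter> U) \<le> card (rooted_edges e (T \<inter> W))"
      using e' T by (intro card_mono card_rooted_edges(1)) auto
    also have "\<dots> = (v + 2 choose 2) - 1"
      using card_rooted_edges(2)[OF e', of "T \<inter> W"] T by auto
    finally have "card (rooted_edges e T \<inter> U) \<le> (v + 2 choose 2) - 1" .
    moreover have "card (rooted_edges e T) = 9"
      using card_rooted_edges(2)[OF e' T(1,3)] T(2) by (simp add: numeral_eq_Suc)
    moreover have "card (rooted_edges e T - U) = card (rooted_edges e T) - card (rooted_edges e T \<inter> U)"
      using card_rooted_edges(1)[OF e' T(1,3)] by (simp add: card_Diff_subset_Int)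
    moreover have "(v + 2 choose 2) \<ge> 1" by (simp add: Suc_le_eq)
    ultimately show "10 - (v + 2 choose 2) \<le> card (rooted_edges e T - U)" by linarith
  qed (use p in auto)
  also have "\<dots> = real (card ?S) * p ^ (10 - (v + 2 choose 2))" by simp
  also have "\<dots> \<le> (real (card W) ^ v * real (card V) ^ (3 - v)) * p ^ (10 - (v + 2 choose 2))"
  proof (rule mult_right_mono)
    have "card ?S \<le> card {T \<in> [V]\<^bsup>3\<^esup>. card (T \<inter> W) = v}"
      by (rule card_mono) (use V nsets_mono[of "V - e" V] in \<open>auto simp: finite_imp_finite_nsets\<close>)
    also have "\<dots> \<le> card W ^ v * card V ^ (3 - v)"
      by (rule card_subsets_meeting_in[OF V W v])
    finally have "real (card ?S) \<le> real (card W ^ v * card V ^ (3 - v))"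
      by (rule of_nat_mono)
    then show "real (card ?S) \<le> real (card W) ^ v * real (card V) ^ (3 - v)"
      by (simp only: of_nat_mult of_nat_power)
  qed (use p in simp)
  finally show ?thesis by (simp add: mult.assoc)
qed

text \<open>Triples disjoint from \<open>W\<close> have total weight at most \<open>M\<close>; those meeting \<open>W\<close> are rarer by
  a factor of order \<open>lam\<close>. The hypothesis on \<open>lam\<close> compares \<open>M\<close> with the expected number of ways to
  complete one, two or three already chosen vertices.\<close>

lemma extension_weight:
  fixes p lam M :: real
  assumes p: "0 < p" "p \<le> 1" and V: "finite V" and e: "e \<in> [V]\<^bsup>2\<^esup>"
    and W: "finite W" "card W \<le> w" "1 \<le> w" and U: "U \<subseteq> [e \<union> W]\<^bsup>2\<^esup>"
    and M: "M = real (card V) ^ 3 * p ^ 9"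
    and lam: "\<And>v. v \<in> {1..3} \<Longrightarrow> real (card V) ^ (3 - v) * p ^ (10 - (v + 2 choose 2)) \<le> lam * M"
  shows "(\<Sum>T\<in>{T \<in> [V - e]\<^bsup>3\<^esup>. T \<inter> W \<noteq> {}}. p ^ card (rooted_edges e T - U)) \<le> 3 * real w ^ 3 * lam * M"
    and "(\<Sum>T\<in>[V - e]\<^bsup>3\<^esup>. p ^ card (rooted_edges e T - U)) \<le> (1 + 3 * real w ^ 3 * lam) * M"
proof -
  let ?F = "[V - e]\<^bsup>3\<^esup>" and ?g = "\<lambda>T. p ^ card (rooted_edges e T - U)"
  let ?L = "\<lambda>v. {T \<in> ?F. card (T \<inter> W) = v}"
  have finF: "finite ?F" using V by (simp add: finite_imp_finite_nsets)
  have lamM: "lam * M \<ge> 0" using lam[of 3] p by (simp add: numeral_eq_Suc)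
  have level: "sum ?g (?L v) \<le> real w ^ 3 * (lam * M)" if v: "v \<in> {1..3}" for v
  proof -
    have "sum ?g (?L v) \<le> real (card W) ^ v * (real (card V) ^ (3 - v) * p ^ (10 - (v + 2 choose 2)))"
      by (rule extension_weight_level[OF p V e W(1) U]) (use v in simp)
    also have "\<dots> \<le> real w ^ 3 * (lam * M)"
    proof (rule mult_mono[OF _ lam[OF v]])
      have "real (card W) ^ v \<le> real w ^ v" using W by (simp add: power_mono)
      also have "\<dots> \<le> real w ^ 3" by (rule power_increasing) (use v W in auto)
      finally show "real (card W) ^ v \<le> real w ^ 3" .
    qed (use p in auto)
    finally show ?thesis .
  qed
  have card_in: "card (T \<inter> W) \<in> {0..3}" if "T \<in> ?F" for T
  proof -
    have "finite T" "card T = 3" using that by (auto simp: nsets_def)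
    then show ?thesis using card_mono[of T "T \<inter> W"] by auto
  qed
  have meet: "{T \<in> ?F. T \<inter> W \<noteq> {}} = (\<Union>v\<in>{1..3}. ?L v)"
  proof (intro set_eqI iffI)
    fix T assume T: "T \<in> {T \<in> ?F. T \<inter> W \<noteq> {}}"
    then have "card (T \<inter> W) > 0" using W(1) by (simp add: card_gt_0_iff)
    then show "T \<in> (\<Union>v\<in>{1..3}. ?L v)" using T card_in[of T] by auto
  qed auto
  have "sum ?g {T \<in> ?F. T \<inter> W \<noteq> {}} = (\<Sum>v\<in>{1..3}. sum ?g (?L v))"
    unfolding meet by (rule sum.UNION_disjoint) (use finF in auto)
  also have "\<dots> \<le> (\<Sum>v\<in>{1..3::nat}. real w ^ 3 * (lam * M))"
    by (rule sum_mono) (rule level)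
  finally show meet_le: "sum ?g {T \<in> ?F. T \<inter> W \<noteq> {}} \<le> 3 * real w ^ 3 * lam * M"
    by (simp add: mult.assoc)
  have "?F = ?L 0 \<union> {T \<in> ?F. T \<inter> W \<noteq> {}}" using W(1) by auto
  then have "sum ?g ?F = sum ?g (?L 0 \<union> {T \<in> ?F. T \<inter> W \<noteq> {}})" by simp
  also have "\<dots> = sum ?g (?L 0) + sum ?g {T \<in> ?F. T \<inter> W \<noteq> {}}"
    by (rule sum.union_disjoint) (use finF W(1) in auto)
  also have "sum ?g (?L 0) \<le> M"
    using extension_weight_level[OF p V e W(1) U, of 0] by (simp add: M numeral_2_eq_2)
  finally show "sum ?g ?F \<le> (1 + 3 * real w ^ 3 * lam) * M"
    using meet_le by (simp add: algebra_simps)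
qed

lemma sum_PiE_insert:
  assumes "i \<notin> I"
  shows "(\<Sum>s\<in>PiE (insert i I) F. h s) = (\<Sum>s\<in>PiE I F. \<Sum>T\<in>F i. h (s(i := T)))"
proof -
  have "(\<Sum>s\<in>PiE (insert i I) F. h s) = (\<Sum>x\<in>F i \<times> PiE I F. h ((snd x)(i := fst x)))"
    unfolding PiE_insert_eq by (subst sum.reindex[OF inj_combinator[OF assms]])
      (simp add: case_prod_unfold)
  also have "\<dots> = (\<Sum>T\<in>F i. \<Sum>s\<in>PiE I F. h (s(i := T)))"
    by (simp add: sum.cartesian_product case_prod_unfold)
  also have "\<dots> = (\<Sum>s\<in>PiE I F. \<Sum>T\<in>F i. h (s(i := T)))" by (rule sum.swap)
  finally show ?thesis .
qed

text \<open>This is Ore's theorem. In a graph without isolated vertices, the complement of a dominating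
  set \<open>D\<close> of least size is again dominating: a vertex of \<open>D\<close> with no neighbour outside \<open>D\<close> has one
  inside \<open>D\<close> and could be dropped. So \<open>D\<close> is at most as large as its complement.\<close>

lemma dominating_set_half:
  assumes "finite I" and sym: "\<And>i j. R i j \<Longrightarrow> R j i"
    and nbr: "\<And>i. i \<in> I \<Longrightarrow> \<exists>j\<in>I - {i}. R i j"
  obtains D where "D \<subseteq> I" "2 * card D \<le> card I" "\<And>i. i \<in> I - D \<Longrightarrow> \<exists>j\<in>D. R i j"
proof -
  define dom where "dom D \<longleftrightarrow> D \<subseteq> I \<and> (\<forall>i\<in>I - D. \<exists>j\<in>D. R i j)" for D
  define D where "D = (ARG_MIN card D. dom D)"
  have "dom I" by (simp add: dom_def)
  then have D: "dom D" unfolding D_def by (rule arg_min_natI)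
  have D_min: "card D \<le> card D'" if "dom D'" for D'
    unfolding D_def using that by (rule arg_min_nat_le)
  have finD: "finite D" using D assms(1) finite_subset unfolding dom_def by blast
  have "dom (I - D)"
    unfolding dom_def
  proof (intro conjI ballI)
    fix x assume "x \<in> I - (I - D)"
    then have x: "x \<in> I" "x \<in> D" by auto
    show "\<exists>j\<in>I - D. R x j"
    proof (rule ccontr)
      assume no: "\<not> ?thesis"
      obtain y where y: "y \<in> I - {x}" "R x y" using nbr[OF x(1)] by blast
      with no have "y \<in> D" by auto
      have "dom (D - {x})"
        unfolding dom_def
      proof (intro conjI ballI)
        fix i assume i: "i \<in> I - (D - {x})"
        show "\<exists>j\<in>D - {x}. R i j"
        proof (cases "i = x")
          case True
          then show ?thesis using y \<open>y \<in> D\<close> by auto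
        next
          case False
          then obtain j where "j \<in> D" "R i j" using i D unfolding dom_def by blast
          moreover have "j \<noteq> x" using no sym \<open>R i j\<close> i False by blast
          ultimately show ?thesis by auto
        qed
      qed (use D in \<open>auto simp: dom_def\<close>)
      from D_min[OF this] show False using x finD by (metis card_Diff1_less not_le)
    qed
  qed auto
  from D_min[OF this] have "2 * card D \<le> card I"
    using D assms(1) finD card_mono[of I D] by (simp add: card_Diff_subset dom_def)
  with D show ?thesis using that unfolding dom_def by blast
qed

text \<open>The triples are summed out one at a time, those indexed by \<open>D\<close> being chosen first. Each costs
  a factor \<open>K * M\<close>, and each index in \<open>J\<close> an additional \<open>lam\<close>, since its triple has to meet an
  earlier one. Here \<open>3 * m\<close> bounds the number of vertices used by at most \<open>m\<close> triples.\<close>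

lemma sequence_weight:
  fixes p lam M :: real and V :: "'a set" and D J :: "'i set"
  assumes p: "0 < p" "p \<le> 1" and V: "finite V" and e: "e \<in> [V]\<^bsup>2\<^esup>"
    and M: "M = real (card V) ^ 3 * p ^ 9"
    and lam: "\<And>v. v \<in> {1..3} \<Longrightarrow> real (card V) ^ (3 - v) * p ^ (10 - (v + 2 choose 2)) \<le> lam * M"
    and lam01: "0 \<le> lam" "lam \<le> 1"
    and K: "K = 1 + 3 * real (3 * m) ^ 3"
    and D: "finite D" and J: "finite J" "D \<inter> J = {}" and m: "card D + card J \<le> m"
  shows "(\<Sum>s\<in>(D \<union> J) \<rightarrow>\<^sub>E [V - e]\<^bsup>3\<^esup>. of_bool (\<forall>i\<in>J. s i \<inter> \<Union>(s ` D) \<noteq> {}) *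
      p ^ card (\<Union>i\<in>D \<union> J. rooted_edges e (s i))) \<le> (K * M) ^ (card D + card J) * lam ^ card J"
proof -
  let ?F = "[V - e]\<^bsup>3\<^esup>" and ?R = "rooted_edges e"
  have e': "finite e" "card e = 2" using e by (auto simp: nsets_def)
  have finR: "finite (?R T)" if "finite T" for T
    using that e' by (simp add: rooted_edges_def finite_imp_finite_nsets)
  have finF: "finite ?F" using V by (simp add: finite_imp_finite_nsets)
  have M0: "M \<ge> 0" using p by (simp add: M)
  have K1: "K \<ge> 1" by (simp add: K)
  \<comment> \<open>the cost of adding one triple \<open>T\<close> to a sequence indexed by \<open>I\<close>\<close>
  have step: "(\<Sum>T\<in>?F. p ^ card (?R T \<union> (\<Union>i\<in>I. ?R (s i)))) \<le> K * M * p ^ card (\<Union>i\<in>I. ?R (s i))"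
    "B \<subseteq> I \<Longrightarrow> (\<Sum>T\<in>?F. of_bool (T \<inter> \<Union>(s ` B) \<noteq> {}) * p ^ card (?R T \<union> (\<Union>i\<in>I. ?R (s i))))
      \<le> K * M * lam * p ^ card (\<Union>i\<in>I. ?R (s i))"
    if I: "finite I" "card I < m" and s: "s \<in> I \<rightarrow>\<^sub>E ?F" for I B and s :: "'i \<Rightarrow> 'a set"
  proof -
    let ?W = "\<Union>(s ` I)" and ?U = "\<Union>i\<in>I. ?R (s i)"
    have si: "finite (s i) \<and> card (s i) = 3" if "i \<in> I" for i
      using s that by (auto simp: PiE_iff nsets_def)
    have finW: "finite ?W" using I si by auto
    have "card ?W \<le> (\<Sum>i\<in>I. card (s i))" by (rule card_UN_le[OF I(1)])
    also have "\<dots> = 3 * card I" using si by simp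
    also have "\<dots> \<le> 3 * m" using I by simp
    finally have cW: "card ?W \<le> 3 * m" .
    have U: "?U \<subseteq> [e \<union> ?W]\<^bsup>2\<^esup>" by (auto simp: rooted_edges_def nsets_def)
    have finU: "finite ?U" using I si finR by auto
    have m1: "1 \<le> 3 * m" using I by simp
    have pow: "p ^ card (?R T \<union> ?U) = p ^ card (?R T - ?U) * p ^ card ?U" if "T \<in> ?F" for T
    proof -
      have "finite (?R T)" using that finR by (auto simp: nsets_def)
      then have "card (?R T \<union> ?U) = card (?R T - ?U) + card ?U"
        using finU by (metis Diff_disjoint Int_commute Un_Diff_cancel2 card_Un_disjoint finite_Diff)
      then show ?thesis by (simp add: power_add)
    qed
    note w = extension_weight[OF p V e finW cW m1 U M lam]
    have le_K: "(1 + 3 * real (3 * m) ^ 3 * lam) * M \<le> K * M"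
      by (rule mult_right_mono) (use lam01 M0 in \<open>auto simp: K intro!: mult_left_le\<close>)
    have "(\<Sum>T\<in>?F. p ^ card (?R T \<union> ?U)) = (\<Sum>T\<in>?F. p ^ card (?R T - ?U)) * p ^ card ?U"
      unfolding sum_distrib_right by (rule sum.cong[OF refl]) (rule pow)
    also have "\<dots> \<le> K * M * p ^ card ?U"
      by (rule mult_right_mono) (use order_trans[OF w(2) le_K] p in auto)
    finally show "(\<Sum>T\<in>?F. p ^ card (?R T \<union> ?U)) \<le> K * M * p ^ card ?U" .
    assume B: "B \<subseteq> I"
    have "(\<Sum>T\<in>?F. of_bool (T \<inter> \<Union>(s ` B) \<noteq> {}) * p ^ card (?R T \<union> ?U))
        \<le> (\<Sum>T\<in>?F. of_bool (T \<inter> ?W \<noteq> {}) * p ^ card (?R T \<union> ?U))"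
      by (rule sum_mono, rule mult_right_mono) (use B p in auto)
    also have "\<dots> = (\<Sum>T\<in>{T \<in> ?F. T \<inter> ?W \<noteq> {}}. p ^ card (?R T \<union> ?U))"
      by (rule sum.mono_neutral_cong_right[OF finF]) auto
    also have "\<dots> = (\<Sum>T\<in>{T \<in> ?F. T \<inter> ?W \<noteq> {}}. p ^ card (?R T - ?U)) * p ^ card ?U"
      unfolding sum_distrib_right by (rule sum.cong[OF refl]) (rule pow, simp)
    also have "\<dots> \<le> (3 * real (3 * m) ^ 3 * lam * M) * p ^ card ?U"
      by (rule mult_right_mono) (use w(1) p in auto)
    also have "\<dots> \<le> (K * lam * M) * p ^ card ?U"
      by (intro mult_right_mono) (use lam01 M0 p in \<open>auto simp: K\<close>)
    finally show "(\<Sum>T\<in>?F. of_bool (T \<inter> \<Union>(s ` B) \<noteq> {}) * p ^ card (?R T \<union> ?U))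
        \<le> K * M * lam * p ^ card ?U" by (simp add: mult_ac)
  qed
  have base: "(\<Sum>s\<in>D \<rightarrow>\<^sub>E ?F. p ^ card (\<Union>i\<in>D. ?R (s i))) \<le> (K * M) ^ card D" if "card D \<le> m"
    using D that
  proof (induction D rule: finite_induct)
    case empty
    then show ?case by simp
  next
    case (insert i I)
    have "(\<Sum>s\<in>insert i I \<rightarrow>\<^sub>E ?F. p ^ card (\<Union>j\<in>insert i I. ?R (s j)))
        = (\<Sum>s\<in>I \<rightarrow>\<^sub>E ?F. \<Sum>T\<in>?F. p ^ card (?R T \<union> (\<Union>j\<in>I. ?R (s j))))"
    proof (subst sum_PiE_insert[OF insert(2)], intro sum.cong refl)
      fix s :: "'i \<Rightarrow> 'a set" and T
      have "(\<Union>j\<in>insert i I. ?R ((s(i := T)) j)) = ?R T \<union> (\<Union>j\<in>I. ?R (s j))"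
        using insert(2) by (auto split: if_splits)
      then show "p ^ card (\<Union>j\<in>insert i I. ?R ((s(i := T)) j)) = p ^ card (?R T \<union> (\<Union>j\<in>I. ?R (s j)))"
        by simp
    qed
    also have "\<dots> \<le> (\<Sum>s\<in>I \<rightarrow>\<^sub>E ?F. K * M * p ^ card (\<Union>j\<in>I. ?R (s j)))"
      by (rule sum_mono, rule step(1)) (use insert in auto)
    also have "\<dots> = K * M * (\<Sum>s\<in>I \<rightarrow>\<^sub>E ?F. p ^ card (\<Union>j\<in>I. ?R (s j)))"
      by (simp add: sum_distrib_left)
    also have "\<dots> \<le> K * M * (K * M) ^ card I"
      by (rule mult_left_mono) (use insert K1 M0 in auto)
    finally show ?case using insert by simp
  qed
  show ?thesis using J m
  proof (induction J rule: finite_induct)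
    case empty
    then show ?case using base by simp
  next
    case (insert i J)
    have i: "i \<notin> D \<union> J" using insert by auto
    have "(\<Sum>s\<in>(D \<union> insert i J) \<rightarrow>\<^sub>E ?F. of_bool (\<forall>j\<in>insert i J. s j \<inter> \<Union>(s ` D) \<noteq> {}) *
          p ^ card (\<Union>j\<in>D \<union> insert i J. ?R (s j)))
        = (\<Sum>s\<in>(D \<union> J) \<rightarrow>\<^sub>E ?F. of_bool (\<forall>j\<in>J. s j \<inter> \<Union>(s ` D) \<noteq> {}) *
          (\<Sum>T\<in>?F. of_bool (T \<inter> \<Union>(s ` D) \<noteq> {}) * p ^ card (?R T \<union> (\<Union>j\<in>D \<union> J. ?R (s j)))))"
      unfolding Un_insert_right
    proof (subst sum_PiE_insert[OF i], subst sum_distrib_left, intro sum.cong refl)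
      fix s :: "'i \<Rightarrow> 'a set" and T
      have *: "(s(i := T)) ` D = s ` D" "j \<in> J \<Longrightarrow> (s(i := T)) j = s j" for j using i by auto
      have "(\<Union>j\<in>insert i (D \<union> J). ?R ((s(i := T)) j)) = ?R T \<union> (\<Union>j\<in>D \<union> J. ?R (s j))"
        using i by (auto split: if_splits)
      moreover have "(\<forall>j\<in>insert i J. (s(i := T)) j \<inter> \<Union>((s(i := T)) ` D) \<noteq> {})
          \<longleftrightarrow> T \<inter> \<Union>(s ` D) \<noteq> {} \<and> (\<forall>j\<in>J. s j \<inter> \<Union>(s ` D) \<noteq> {})"
        unfolding *(1) using *(2) by auto
      ultimately show "of_bool (\<forall>j\<in>insert i J. (s(i := T)) j \<inter> \<Union>((s(i := T)) ` D) \<noteq> {}) *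
            p ^ card (\<Union>j\<in>insert i (D \<union> J). ?R ((s(i := T)) j))
          = of_bool (\<forall>j\<in>J. s j \<inter> \<Union>(s ` D) \<noteq> {}) *
            (of_bool (T \<inter> \<Union>(s ` D) \<noteq> {}) * p ^ card (?R T \<union> (\<Union>j\<in>D \<union> J. ?R (s j))))"
        by simp
    qed
    also have "\<dots> \<le> (\<Sum>s\<in>(D \<union> J) \<rightarrow>\<^sub>E ?F. of_bool (\<forall>j\<in>J. s j \<inter> \<Union>(s ` D) \<noteq> {}) *
        (K * M * lam * p ^ card (\<Union>j\<in>D \<union> J. ?R (s j))))"
    proof (rule sum_mono, rule mult_left_mono, rule step(2))
      have "card (D \<union> J) \<le> card D + card J" by (rule card_Un_le)
      then show "card (D \<union> J) < m" using insert by simp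
    qed (use D insert in auto)
    also have "\<dots> = K * M * lam * (\<Sum>s\<in>(D \<union> J) \<rightarrow>\<^sub>E ?F. of_bool (\<forall>j\<in>J. s j \<inter> \<Union>(s ` D) \<noteq> {}) *
        p ^ card (\<Union>j\<in>D \<union> J. ?R (s j)))"
      by (simp add: sum_distrib_left mult_ac)
    also have "\<dots> \<le> K * M * lam * ((K * M) ^ (card D + card J) * lam ^ card J)"
      by (rule mult_left_mono) (use insert K1 M0 lam01 in auto)
    finally show ?case using insert by (simp add: mult_ac)
  qed
qed

section \<open>Concentration of five-clique counts\<close>

text \<open>The expansion of the moment has one term for each sequence of \<open>2k\<close> triples. Terms with an
  isolated triple vanish; any other sequence is counted by some dominating set \<open>D\<close> of at most \<open>k\<close>
  indices, and \<open>sequence_weight\<close> applies to \<open>D\<close> and its complement. One factor \<open>4 ^ k\<close> comes from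
  the bound for a centred product of \<open>2k\<close> indicators, another from the number of possible \<open>D\<close>.\<close>

lemma central_moment_bound:
  fixes p lam M :: real
  assumes p: "0 < p" "p \<le> 1" and e: "e \<in> [{1..n}]\<^bsup>2\<^esup>"
    and M: "M = real n ^ 3 * p ^ 9"
    and lam: "\<And>v. v \<in> {1..3} \<Longrightarrow> real n ^ (3 - v) * p ^ (10 - (v + 2 choose 2)) \<le> lam * M"
    and lam01: "0 \<le> lam" "lam \<le> 1"
    and K: "K = 1 + 3 * real (3 * (2 * k)) ^ 3"
  shows "measure_pmf.expectation (gnp n p)
     (\<lambda>G. (real (card {T \<in> [{1..n} - e]\<^bsup>3\<^esup>. rooted_edges e T \<subseteq> G}) - real (n - 2 choose 3) * p ^ 9) ^ (2 * k))
    \<le> (4 * K * M) ^ (2 * k) * lam ^ k"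
proof -
  let ?F = "[{1..n} - e]\<^bsup>3\<^esup>" and ?R = "rooted_edges e" and ?I = "{..<2 * k}"
  let ?E = "measure_pmf.expectation (gnp n p)"
  let ?S = "?I \<rightarrow>\<^sub>E ?F"
  let ?cond = "\<lambda>D s. \<forall>i\<in>?I - D. s i \<inter> \<Union>(s ` D) \<noteq> {}"
  let ?DD = "{D \<in> Pow ?I. card D \<le> k}"
  have e': "finite e" "card e = 2" "e \<subseteq> {1..n}" using e by (auto simp: nsets_def)
  have finF: "finite ?F" by (simp add: finite_imp_finite_nsets)
  have finS: "finite ?S" by (rule finite_PiE) (use finF in auto)
  have card9: "card (?R T) = 9" if "T \<in> ?F" for T
  proof -
    have "finite T" "e \<inter> T = {}" "card T = 3" using that by (auto simp: nsets_def)
    then show ?thesis using card_rooted_edges(2)[OF e'(1,2)] by (simp add: numeral_eq_Suc)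
  qed
  have Rsub: "?R T \<subseteq> [{1..n}]\<^bsup>2\<^esup>" if "T \<in> ?F" for T
    using that e' by (auto simp: rooted_edges_def nsets_def)
  have M0: "M \<ge> 0" and K0: "K \<ge> 0" using p by (simp_all add: M K)
  have expand: "(real (card {T \<in> ?F. ?R T \<subseteq> G}) - real (n - 2 choose 3) * p ^ 9) ^ (2 * k)
      = (\<Sum>s\<in>?S. \<Prod>i\<in>?I. of_bool (?R (s i) \<subseteq> G) - p ^ card (?R (s i)))" for G
  proof -
    have "card ?F = (n - 2 choose 3)" using e' by (simp add: card_Diff_subset)
    then have mean: "real (n - 2 choose 3) * p ^ 9 = (\<Sum>T\<in>?F. p ^ card (?R T))"
      by (simp add: card9 del: card_nsets)
    have count: "real (card {T \<in> ?F. ?R T \<subseteq> G}) = (\<Sum>T\<in>?F. of_bool (?R T \<subseteq> G))"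
      using finF by (simp add: of_bool_def sum.If_cases Int_def)
    have "(real (card {T \<in> ?F. ?R T \<subseteq> G}) - real (n - 2 choose 3) * p ^ 9) ^ (2 * k)
        = (\<Prod>i\<in>?I. \<Sum>T\<in>?F. of_bool (?R T \<subseteq> G) - p ^ card (?R T))"
      unfolding mean count by (simp add: sum_subtractf)
    also have "\<dots> = (\<Sum>s\<in>?S. \<Prod>i\<in>?I. of_bool (?R (s i) \<subseteq> G) - p ^ card (?R (s i)))"
      by (rule prod_sum_PiE) (use finF in auto)
    finally show ?thesis .
  qed
  have summand: "?E (\<lambda>G. \<Prod>i\<in>?I. of_bool (?R (s i) \<subseteq> G) - p ^ card (?R (s i)))
      \<le> (\<Sum>D\<in>?DD. 4 ^ k * (of_bool (?cond D s) * p ^ card (\<Union>i\<in>?I. ?R (s i))))"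
    (is "?lhs \<le> ?rhs") if s: "s \<in> ?S" for s
  proof -
    have sF: "s i \<in> ?F" if "i \<in> ?I" for i using s that by auto
    have A: "?R (s i) \<subseteq> [{1..n}]\<^bsup>2\<^esup>" if "i \<in> ?I" for i using Rsub[OF sF[OF that]] .
    have nonneg: "0 \<le> 4 ^ k * (of_bool (?cond D s) * p ^ card (\<Union>i\<in>?I. ?R (s i)))" for D
      using p by simp
    show ?thesis
    proof (cases "\<exists>i\<in>?I. \<forall>j\<in>?I - {i}. s j \<inter> s i = {}")
      case True
      then obtain i where i: "i \<in> ?I" "\<And>j. j \<in> ?I - {i} \<Longrightarrow> s j \<inter> s i = {}" by blast
      have "?lhs = 0"
        by (rule centred_product_zero[OF _ p(2) _ A i(1)])
          (use p i(2) rooted_edges_disjoint[OF e'(1,2)] in auto)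
      also have "0 \<le> ?rhs" by (rule sum_nonneg) (rule nonneg)
      finally show ?thesis .
    next
      case False
      obtain D where D: "D \<subseteq> ?I" "2 * card D \<le> card ?I" "\<And>i. i \<in> ?I - D \<Longrightarrow> \<exists>j\<in>D. s i \<inter> s j \<noteq> {}"
        by (rule dominating_set_half[of ?I "\<lambda>i j. s i \<inter> s j \<noteq> {}"]) (use False in blast)+
      have DD: "D \<in> ?DD" and "?cond D s" using D by fastforce+
      have "?lhs \<le> 2 ^ card ?I * p ^ card (\<Union>i\<in>?I. ?R (s i))"
        using centred_product_bound[OF _ p(2), of ?I "\<lambda>i. ?R (s i)" n] p A by auto
      also have "\<dots> = 4 ^ k * (of_bool (?cond D s) * p ^ card (\<Union>i\<in>?I. ?R (s i)))"
        using \<open>?cond D s\<close> by (simp add: power_mult)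
      also have "\<dots> \<le> ?rhs"
        by (rule member_le_sum[OF DD]) (use nonneg in auto)
      finally show ?thesis .
    qed
  qed
  have "?E (\<lambda>G. (real (card {T \<in> ?F. ?R T \<subseteq> G}) - real (n - 2 choose 3) * p ^ 9) ^ (2 * k))
      = (\<Sum>s\<in>?S. ?E (\<lambda>G. \<Prod>i\<in>?I. of_bool (?R (s i) \<subseteq> G) - p ^ card (?R (s i))))"
    unfolding expand by (rule Bochner_Integration.integral_sum) (rule integrable_gnp)
  also have "\<dots> \<le> (\<Sum>s\<in>?S. \<Sum>D\<in>?DD. 4 ^ k * (of_bool (?cond D s) * p ^ card (\<Union>i\<in>?I. ?R (s i))))"
    by (rule sum_mono) (rule summand)
  also have "\<dots> = (\<Sum>D\<in>?DD. 4 ^ k * (\<Sum>s\<in>?S. of_bool (?cond D s) * p ^ card (\<Union>i\<in>?I. ?R (s i))))"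
    by (subst sum.swap) (simp add: sum_distrib_left)
  also have "\<dots> \<le> (\<Sum>D\<in>?DD. 4 ^ k * ((K * M) ^ (2 * k) * lam ^ k))"
  proof (rule sum_mono, rule mult_left_mono)
    fix D assume "D \<in> ?DD"
    then have D: "D \<subseteq> ?I" "card D \<le> k" by auto
    have finD: "finite D" using D finite_subset by blast
    have c: "card D + card (?I - D) = 2 * k"
      using D finD card_mono[of ?I D] by (simp add: card_Diff_subset)
    have un: "D \<union> (?I - D) = ?I" using D by auto
    have "(\<Sum>s\<in>?S. of_bool (?cond D s) * p ^ card (\<Union>i\<in>?I. ?R (s i)))
        \<le> (K * M) ^ (2 * k) * lam ^ card (?I - D)"
      using sequence_weight[OF p _ e _ _ lam01 K finD, of M "?I - D"] M lam c
      unfolding un by simp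
    also have "\<dots> \<le> (K * M) ^ (2 * k) * lam ^ k"
      by (intro mult_left_mono power_decreasing) (use c D lam01 K0 M0 in auto)
    finally show "(\<Sum>s\<in>?S. of_bool (?cond D s) * p ^ card (\<Union>i\<in>?I. ?R (s i)))
        \<le> (K * M) ^ (2 * k) * lam ^ k" .
  qed simp
  also have "\<dots> = real (card ?DD) * (4 ^ k * ((K * M) ^ (2 * k) * lam ^ k))" by simp
  also have "\<dots> \<le> 4 ^ k * (4 ^ k * ((K * M) ^ (2 * k) * lam ^ k))"
  proof (rule mult_right_mono)
    have "card ?DD \<le> card (Pow ?I)" by (rule card_mono) auto
    also have "\<dots> = 4 ^ k" by (simp add: card_Pow power_mult)
    finally have "real (card ?DD) \<le> real (4 ^ k)" by (rule of_nat_mono)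
    then show "real (card ?DD) \<le> 4 ^ k" by (simp only: of_nat_power of_nat_numeral)
  qed (use lam01 K0 M0 in simp)
  also have "\<dots> = (4 * K * M) ^ (2 * k) * lam ^ k"
    by (simp add: power_mult power_mult_distrib power2_eq_square mult_ac)
  finally show ?thesis .
qed

text \<open>For a pair that is an edge of the graph, the number of extensions, which is what
  the moment bound controls, is the number of five-cliques that the decomposition needs.\<close>

lemma card_five_cliques_containing_edge:
  assumes G: "G \<subseteq> [V]\<^bsup>2\<^esup>" and e: "e \<in> G"
  shows "card {H \<in> five_cliques G. e \<subseteq> H} = card {T \<in> [V - e]\<^bsup>3\<^esup>. rooted_edges e T \<subseteq> G}"
proof (rule bij_betw_same_card[symmetric])
  have e': "finite e" "card e = 2" "e \<subseteq> V" using G e by (auto simp: nsets_def)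
  have UG: "\<Union>G \<subseteq> V" using G by (auto simp: nsets_def)
  show "bij_betw (\<lambda>T. e \<union> T) {T \<in> [V - e]\<^bsup>3\<^esup>. rooted_edges e T \<subseteq> G} {H \<in> five_cliques G. e \<subseteq> H}"
  proof (rule bij_betw_imageI)
    show "inj_on (\<lambda>T. e \<union> T) {T \<in> [V - e]\<^bsup>3\<^esup>. rooted_edges e T \<subseteq> G}"
      by (rule inj_onI) (auto simp: nsets_def)
    show "(\<lambda>T. e \<union> T) ` {T \<in> [V - e]\<^bsup>3\<^esup>. rooted_edges e T \<subseteq> G} = {H \<in> five_cliques G. e \<subseteq> H}"
    proof (intro set_eqI iffI)
      fix H assume "H \<in> (\<lambda>T. e \<union> T) ` {T \<in> [V - e]\<^bsup>3\<^esup>. rooted_edges e T \<subseteq> G}"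
      then obtain T where T: "T \<subseteq> V - e" "finite T" "card T = 3" "rooted_edges e T \<subseteq> G" "H = e \<union> T"
        by (auto simp: nsets_def)
      then have "card H = 5" using e' by (subst \<open>H = e \<union> T\<close>, subst card_Un_disjoint) auto
      moreover have "[H]\<^bsup>2\<^esup> \<subseteq> G" using T e by (auto simp: rooted_edges_def)
      ultimately show "H \<in> {H \<in> five_cliques G. e \<subseteq> H}" using T by (auto simp: five_cliques_def)
    next
      fix H assume "H \<in> {H \<in> five_cliques G. e \<subseteq> H}"
      then have H: "card H = 5" "[H]\<^bsup>2\<^esup> \<subseteq> G" "e \<subseteq> H" by (auto simp: five_cliques_def)
      then have "H \<subseteq> V" using clique_subset_Union[of H G] UG by auto
      moreover have "finite H" using H(1) by (simp add: card_ge_0_finite)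
      moreover have un: "e \<union> (H - e) = H" using H by auto
      ultimately have "H - e \<in> {T \<in> [V - e]\<^bsup>3\<^esup>. rooted_edges e T \<subseteq> G}"
        using H e' by (auto simp: nsets_def rooted_edges_def card_Diff_subset)
      then show "H \<in> (\<lambda>T. e \<union> T) ` {T \<in> [V - e]\<^bsup>3\<^esup>. rooted_edges e T \<subseteq> G}"
        using un by (metis image_eqI)
    qed
  qed
qed

text \<open>Markov's inequality for the moment of order \<open>2k\<close> is applied to every pair \<open>e\<close>, whether or not
  it is an edge, with the deviation \<open>\<mu> / 20\<close> that the decomposition tolerates. The constant comes from
  \<open>\<mu> \<ge> M / 64\<close> for \<open>n \<ge> 8\<close>, as \<open>4 * 20 * 64 = 5120\<close>.\<close>

lemma prob_decomposition_lower_bound: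
  fixes p lam :: real
  assumes p: "0 < p" "p \<le> 1" and n: "n \<ge> 8" and M: "M = real n ^ 3 * p ^ 9"
    and lam: "\<And>v. v \<in> {1..3} \<Longrightarrow> real n ^ (3 - v) * p ^ (10 - (v + 2 choose 2)) \<le> lam * M"
    and lam01: "0 \<le> lam" "lam \<le> 1"
    and K: "K = 1 + 3 * real (3 * (2 * k)) ^ 3"
  shows "1 - real n ^ 2 * ((5120 * K) ^ (2 * k) * lam ^ k)
    \<le> measure_pmf.prob (gnp n p) {G. \<exists>\<psi>. fractional_K3_decomposition G \<psi>}"
proof -
  let ?P = "measure_pmf.prob (gnp n p)" and ?E = "[{1..n}]\<^bsup>2\<^esup>"
  define \<mu> where "\<mu> = real (n - 2 choose 3) * p ^ 9"
  define X where "X e G = real (card {T \<in> [{1..n} - e]\<^bsup>3\<^esup>. rooted_edges e T \<subseteq> G})" for e G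
  define Bad where "Bad e = {G. (\<mu> / 20) ^ (2 * k) \<le> (X e G - \<mu>) ^ (2 * k)}" for e
  have M0: "M > 0" using p n by (simp add: M)
  have \<mu>_ge: "\<mu> \<ge> M / 64"
  proof -
    have "(real n / 4) ^ 3 \<le> (real (n - 2) / real 3) ^ 3"
      by (rule power_mono) (use n in \<open>auto simp: of_nat_diff field_simps\<close>)
    also have "\<dots> \<le> real (n - 2 choose 3)"
      by (rule binomial_ge_n_over_k_pow_k) (use n in simp)
    finally have "(real n / 4) ^ 3 * p ^ 9 \<le> \<mu>"
      unfolding \<mu>_def by (rule mult_right_mono) (use p in simp)
    then show ?thesis by (simp add: M power_divide)
  qed
  then have \<mu>0: "\<mu> > 0" using M0 by simp
  have bad: "?P (Bad e) \<le> (5120 * K) ^ (2 * k) * lam ^ k" if e: "e \<in> ?E" for e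
  proof -
    have "?P (Bad e) \<le> measure_pmf.expectation (gnp n p) (\<lambda>G. (X e G - \<mu>) ^ (2 * k)) / (\<mu> / 20) ^ (2 * k)"
      using integral_Markov_inequality_measure[OF integrable_gnp, where A = "{}"
          and c = "(\<mu> / 20) ^ (2 * k)" and u = "\<lambda>G. (X e G - \<mu>) ^ (2 * k)"] \<mu>0
      by (simp add: Bad_def power_mult)
    also have "\<dots> \<le> ((4 * K * M) ^ (2 * k) * lam ^ k) / (\<mu> / 20) ^ (2 * k)"
      unfolding X_def \<mu>_def
      by (rule divide_right_mono[OF central_moment_bound[OF p e M lam lam01 K]])
        (simp_all add: power_mult)
    also have "\<dots> \<le> ((4 * K * M) ^ (2 * k) * lam ^ k) / (M / 1280) ^ (2 * k)"
      by (rule divide_left_mono) (use \<mu>_ge \<mu>0 M0 lam01 K in \<open>auto intro!: power_mono\<close>)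
    also have "\<dots> = (5120 * K) ^ (2 * k) * lam ^ k"
    proof -
      have "5120 * K = 4 * K * M / (M / 1280)" using M0 by simp
      then show ?thesis by (simp only: power_divide times_divide_eq_left)
    qed
    finally show ?thesis .
  qed
  have finE: "finite ?E" by (simp add: finite_imp_finite_nsets)
  have "?P (\<Union>e\<in>?E. Bad e) \<le> (\<Sum>e\<in>?E. ?P (Bad e))"
    by (rule measure_pmf.finite_measure_subadditive_finite[OF finE]) auto
  also have "\<dots> \<le> (\<Sum>e\<in>?E. (5120 * K) ^ (2 * k) * lam ^ k)"
    by (rule sum_mono) (rule bad)
  also have "\<dots> = real (n choose 2) * ((5120 * K) ^ (2 * k) * lam ^ k)" by simp
  also have "\<dots> \<le> real n ^ 2 * ((5120 * K) ^ (2 * k) * lam ^ k)"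
  proof (rule mult_right_mono)
    show "real (n choose 2) \<le> real n ^ 2"
      using binomial_le_pow[of 2 n] n of_nat_mono[of "n choose 2" "n ^ 2"] by simp
  qed (use lam01 K in simp)
  finally have "1 - real n ^ 2 * ((5120 * K) ^ (2 * k) * lam ^ k) \<le> 1 - ?P (\<Union>e\<in>?E. Bad e)" by simp
  also have "\<dots> = ?P (- (\<Union>e\<in>?E. Bad e))"
    using measure_pmf.prob_compl[of "\<Union>e\<in>?E. Bad e" "gnp n p"] by (simp add: Compl_eq_Diff_UNIV)
  also have "\<dots> \<le> ?P {G. \<exists>\<psi>. fractional_K3_decomposition G \<psi>}"
  proof (rule measure_pmf.finite_measure_mono_AE)
    show "AE G in measure_pmf (gnp n p). G \<in> - (\<Union>e\<in>?E. Bad e) \<longrightarrow> G \<in> {G. \<exists>\<psi>. fractional_K3_decomposition G \<psi>}"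
    proof (rule AE_pmfI, rule impI)
      fix G assume "G \<in> set_pmf (gnp n p)" and good: "G \<in> - (\<Union>e\<in>?E. Bad e)"
      then have G: "G \<subseteq> ?E" using set_pmf_gnp by blast
      have "\<exists>\<psi>. fractional_K3_decomposition G \<psi>"
      proof (rule decomposition_if_regular_five_cliques[OF _ \<mu>0])
        show "finite G" using G finE finite_subset by blast
        fix e assume e: "e \<in> G"
        then show "card e = 2" using G by (auto simp: nsets_def)
        have "\<not> (\<mu> / 20) ^ (2 * k) \<le> \<bar>X e G - \<mu>\<bar> ^ (2 * k)"
          using good e G by (auto simp: Bad_def power_even_abs)
        then have "\<bar>X e G - \<mu>\<bar> \<le> \<mu> / 20"
          using power_mono[of "\<mu> / 20" "\<bar>X e G - \<mu>\<bar>" "2 * k"] \<mu>0 by linarith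
        then show "\<bar>real (card {H \<in> five_cliques G. e \<subseteq> H}) - \<mu>\<bar> \<le> \<mu> / 20"
          by (simp add: card_five_cliques_containing_edge[OF G e] X_def)
      qed
      then show "G \<in> {G. \<exists>\<psi>. fractional_K3_decomposition G \<psi>}" by simp
    qed
  qed auto
  finally show ?thesis .
qed

section \<open>The fractional decomposition\<close>

text \<open>Completing one, two or three chosen vertices is rarer than completing none by the factors
  \<open>n p\<^sup>2\<close>, \<open>n\<^sup>2 p\<^sup>5\<close> and \<open>n\<^sup>3 p\<^sup>9\<close>, which are the powers of \<open>n\<close> with exponents \<open>1/3 + 2\<beta>\<close>,
  \<open>1/3 + 5\<beta>\<close> and \<open>9\<beta>\<close>. All of them are at least \<open>n\<close> to the power \<open>c\<close>, and a moment of order \<open>2k\<close>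
  with \<open>c k \<ge> 3\<close> gives failure probability of order \<open>1 / n\<close>. The last factor is where the
  exponent \<open>-1/3\<close> comes from: an edge lies in about \<open>n\<^sup>3 p\<^sup>9\<close> five-cliques.\<close>

theorem theorem1p17:
  fixes \<beta> :: real and p :: "nat \<Rightarrow> real"
  assumes "\<beta> > 0"
    and "\<And>n. p n = real n powr (- 1 / 3 + \<beta>)"
    and "\<And>n. p n \<le> 1"
  shows "(\<lambda>n. measure_pmf.prob (gnp n (p n)) {G. \<exists>\<psi>. fractional_K3_decomposition G \<psi>})
           \<longlonglongrightarrow> 1"
proof -
  let ?f = "\<lambda>n. measure_pmf.prob (gnp n (p n)) {G. \<exists>\<psi>. fractional_K3_decomposition G \<psi>}"
  define c where "c = min (1 / 3) (9 * \<beta>)"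
  have c: "c > 0" "c \<le> 1 / 3" "c \<le> 9 * \<beta>" using assms(1) by (auto simp: c_def)
  obtain k :: nat where "3 / c < real k" using reals_Archimedean2 by blast
  then have k: "3 \<le> real k * c" using c by (simp add: field_simps)
  define C where "C = (5120 * (1 + 3 * real (3 * (2 * k)) ^ 3)) ^ (2 * k)"
  have lower: "1 - C / real n \<le> ?f n" if n: "n \<ge> 8" for n
  proof -
    define lam where "lam = real n powr (- c)"
    define M where "M = real n ^ 3 * p n ^ 9"
    have n1: "1 \<le> real n" and n0: "0 < real n" using n by simp_all
    have pp: "0 < p n" unfolding assms(2) using n by simp
    have np: "real n ^ i * p n ^ j = real n powr (i + j * (- 1 / 3 + \<beta>))" for i j
      unfolding assms(2) using n0
      by (simp add: powr_add powr_powr mult.commute flip: powr_realpow)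
    have lam01: "0 \<le> lam" "lam \<le> 1"
      using powr_mono[OF _ n1, of "- c" 0] n0 c by (simp_all add: lam_def)
    have spread: "real n ^ (3 - v) * p n ^ (10 - (v + 2 choose 2)) \<le> lam * M" if v: "v \<in> {1..3}" for v
    proof -
      have "real n ^ (3 - v) * p n ^ (10 - (v + 2 choose 2))
          \<le> real n powr (- c + (3 + 9 * (- 1 / 3 + \<beta>)))"
        unfolding np
      proof (rule powr_mono[OF _ n1])
        have "v = 1 \<or> v = 2 \<or> v = 3" using v by auto
        then show "real (3 - v) + real (10 - (v + 2 choose 2)) * (- 1 / 3 + \<beta>)
            \<le> - c + (3 + 9 * (- 1 / 3 + \<beta>))"
          using c assms(1) by (auto simp: numeral_eq_Suc)
      qed
      also have "\<dots> = lam * M"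
        unfolding lam_def M_def np by (subst powr_add) simp
      finally show ?thesis .
    qed
    have "lam ^ k = real n powr (- (real k * c))"
      using n0 by (simp add: lam_def powr_power mult.commute)
    moreover have "real n ^ 2 = real n powr 2" using n0 by simp
    ultimately have "real n ^ 2 * lam ^ k = real n powr (2 + - (real k * c))"
      by (simp only: powr_add)
    also have "\<dots> \<le> real n powr (- 1)"
      by (rule powr_mono[OF _ n1]) (use k in simp)
    also have "\<dots> = 1 / real n" using n0 by (simp add: powr_minus_divide)
    finally have "C * (real n ^ 2 * lam ^ k) \<le> C * (1 / real n)"
      by (rule mult_left_mono) (simp add: C_def)
    then have "1 - C / real n \<le> 1 - real n ^ 2 * (C * lam ^ k)" by (simp add: mult_ac)
    also have "\<dots> \<le> ?f n"
      unfolding C_def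
      by (rule prob_decomposition_lower_bound[OF pp assms(3) n M_def spread lam01 refl])
    finally show ?thesis .
  qed
  show ?thesis
  proof (rule tendsto_sandwich)
    show "\<forall>\<^sub>F n in sequentially. 1 - C / real n \<le> ?f n"
      using lower by (rule eventually_sequentiallyI)
    show "\<forall>\<^sub>F n in sequentially. ?f n \<le> 1" by simp
    show "(\<lambda>n. 1 - C / real n) \<longlonglongrightarrow> 1"
      using tendsto_diff[OF tendsto_const[of 1] lim_const_over_n[of C]] by simp
  qed simp
qed

end
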